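(* Let $\mathbb{V}$ be a pointed variety of universal algebras (i.e. with a unique constant $0$) having a binary term $\circ$ and a unary term $\upsilon$ such that $$a\circ 0=0\circ a\quad\text{and}\quad \upsilon(a\circ 0)=a .$$ Then the variety $\mathbb{V}$, viewed as a category, is congruence hyperextensible.
   Context: A variety is pointed when it has exactly one constant $0$, so that $\{0\}$ is a subalgebra of any algebra and the one-element algebra is both terminal and initial. For a map $f$, $R[f]$ is its kernel equivalence relation. In a pointed category a punctual span is a pair of split epimorphisms $f:W\to X$, $g:W\to Z$ with given sections $s$ of $f$ and $t$ of $g$ such that $f t=0$ and $g s=0$. A pointed finitely complete category $\mathbb{E}$ is congruence hyperextensible when, for any punctual span $(f,s,g,t)$ on $W$ and any equivalence relation $T$ on $W$ with $R[f]\cap R[g]\subset T$, one has $R[f]\cap g^{-1}(t^{-1}(T))\subset T$; i.e. if $x\,R[f]\,x'$ and $tg(x)\,T\,tg(x')$ then $x\,T\,x'$. *)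

theory Defs
  imports Main "HOL-Library.FuncSet"
begin

section \<open>Categories\<close>

record ('o, 'm) cat_data =
  Obj :: "'o set"
  Arr :: "'m set"
  Dom :: "'m \<Rightarrow> 'o"
  Cod :: "'m \<Rightarrow> 'o"
  Ident :: "'o \<Rightarrow> 'm"
  Comp :: "'m \<Rightarrow> 'm \<Rightarrow> 'm"  (infixr "\<cdot>\<index>" 75)

definition hom_set :: "('o, 'm) cat_data \<Rightarrow> 'o \<Rightarrow> 'o \<Rightarrow> 'm set" where
  "hom_set C A B = {f \<in> Arr C. Dom C f = A \<and> Cod C f = B}"

locale category =
  fixes C :: "('o, 'm) cat_data" (structure)
  assumes Dom_Obj: "f \<in> Arr C \<Longrightarrow> Dom C f \<in> Obj C"
    and Cod_Obj: "f \<in> Arr C \<Longrightarrow> Cod C f \<in> Obj C"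
    and Ident_hom: "A \<in> Obj C \<Longrightarrow> Ident C A \<in> hom_set C A A"
    and Comp_hom: "f \<in> hom_set C A B \<Longrightarrow> g \<in> hom_set C B D \<Longrightarrow> g \<cdot> f \<in> hom_set C A D"
    and Ident_left: "f \<in> hom_set C A B \<Longrightarrow> Ident C B \<cdot> f = f"
    and Ident_right: "f \<in> hom_set C A B \<Longrightarrow> f \<cdot> Ident C A = f"
    and Comp_assoc: "f \<in> hom_set C A B \<Longrightarrow> g \<in> hom_set C B D \<Longrightarrow> h \<in> hom_set C D F
      \<Longrightarrow> (h \<cdot> g) \<cdot> f = h \<cdot> (g \<cdot> f)"

definition zero_object :: "('o, 'm) cat_data \<Rightarrow> 'o \<Rightarrow> bool" where
  "zero_object C Z \<longleftrightarrow> Z \<in> Obj C \<and>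
     (\<forall>A\<in>Obj C. (\<exists>!f. f \<in> hom_set C A Z) \<and> (\<exists>!f. f \<in> hom_set C Z A))"

definition pointed_category :: "('o, 'm) cat_data \<Rightarrow> bool" where
  "pointed_category C \<longleftrightarrow> (\<exists>Z. zero_object C Z)"

definition zero_arrow :: "('o, 'm) cat_data \<Rightarrow> 'o \<Rightarrow> 'o \<Rightarrow> 'm \<Rightarrow> bool" where
  "zero_arrow C A B f \<longleftrightarrow>
     (\<exists>Z h k. zero_object C Z \<and> h \<in> hom_set C A Z \<and> k \<in> hom_set C Z B \<and> f = k \<cdot>\<^bsub>C\<^esub> h)"

text \<open>
  Finite limits are limits of diagrams indexed by finite directed graphs. An edge is a triple
  consisting of its source, the arrow that the diagram assigns to it, and its target; no
  commutativity is asked of the diagram. A diagram indexed by a finite category has the same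
  cones as its underlying graph.
\<close>

definition finite_diagram ::
    "('o, 'm) cat_data \<Rightarrow> nat set \<Rightarrow> (nat \<Rightarrow> 'o) \<Rightarrow> (nat \<times> 'm \<times> nat) set \<Rightarrow> bool" where
  "finite_diagram C N D E \<longleftrightarrow> finite N \<and> finite E \<and> (\<forall>i\<in>N. D i \<in> Obj C) \<and>
     (\<forall>(i, m, j)\<in>E. i \<in> N \<and> j \<in> N \<and> m \<in> hom_set C (D i) (D j))"

definition cone_over ::
    "('o, 'm) cat_data \<Rightarrow> nat set \<Rightarrow> (nat \<Rightarrow> 'o) \<Rightarrow> (nat \<times> 'm \<times> nat) set
      \<Rightarrow> 'o \<Rightarrow> (nat \<Rightarrow> 'm) \<Rightarrow> bool" where
  "cone_over C N D E L p \<longleftrightarrow> L \<in> Obj C \<and> (\<forall>i\<in>N. p i \<in> hom_set C L (D i)) \<and>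
     (\<forall>(i, m, j)\<in>E. m \<cdot>\<^bsub>C\<^esub> p i = p j)"

definition limit_cone ::
    "('o, 'm) cat_data \<Rightarrow> nat set \<Rightarrow> (nat \<Rightarrow> 'o) \<Rightarrow> (nat \<times> 'm \<times> nat) set
      \<Rightarrow> 'o \<Rightarrow> (nat \<Rightarrow> 'm) \<Rightarrow> bool" where
  "limit_cone C N D E L p \<longleftrightarrow> cone_over C N D E L p \<and>
     (\<forall>L' p'. cone_over C N D E L' p' \<longrightarrow>
        (\<exists>!h. h \<in> hom_set C L' L \<and> (\<forall>i\<in>N. p i \<cdot>\<^bsub>C\<^esub> h = p' i)))"

definition finitely_complete :: "('o, 'm) cat_data \<Rightarrow> bool" where
  "finitely_complete C \<longleftrightarrow>
     (\<forall>N D E. finite_diagram C N D E \<longrightarrow> (\<exists>L p. limit_cone C N D E L p))"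

section \<open>Internal relations\<close>

text \<open>
  A relation on \<open>W\<close> is a jointly monic pair \<open>r0, r1 : R \<rightarrow> W\<close>. It is handled through its
  generalised elements: for each object \<open>A\<close> the set of pairs of arrows \<open>A \<rightarrow> W\<close> that factor
  through it. By the Yoneda lemma, inclusion of relations as subobjects of \<open>W \<times> W\<close> is
  inclusion of the sets of generalised elements at every object \<open>A\<close>, and intersections and
  inverse images are computed on generalised elements.
\<close>

definition relation_on ::
    "('o, 'm) cat_data \<Rightarrow> 'o \<Rightarrow> 'o \<Rightarrow> 'm \<Rightarrow> 'm \<Rightarrow> bool" where
  "relation_on C W R r0 r1 \<longleftrightarrow> r0 \<in> hom_set C R W \<and> r1 \<in> hom_set C R W \<and>
     (\<forall>A\<in>Obj C. \<forall>h\<in>hom_set C A R. \<forall>k\<in>hom_set C A R.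
        r0 \<cdot>\<^bsub>C\<^esub> h = r0 \<cdot>\<^bsub>C\<^esub> k \<and> r1 \<cdot>\<^bsub>C\<^esub> h = r1 \<cdot>\<^bsub>C\<^esub> k \<longrightarrow> h = k)"

definition rel_elems :: "('o, 'm) cat_data \<Rightarrow> 'o \<Rightarrow> 'm \<Rightarrow> 'm \<Rightarrow> 'o \<Rightarrow> ('m \<times> 'm) set" where
  "rel_elems C R r0 r1 A = {(r0 \<cdot>\<^bsub>C\<^esub> h, r1 \<cdot>\<^bsub>C\<^esub> h) | h. h \<in> hom_set C A R}"

definition equivalence_relation_on ::
    "('o, 'm) cat_data \<Rightarrow> 'o \<Rightarrow> 'o \<Rightarrow> 'm \<Rightarrow> 'm \<Rightarrow> bool" where
  "equivalence_relation_on C W R r0 r1 \<longleftrightarrow> relation_on C W R r0 r1 \<and>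
     (\<forall>A\<in>Obj C. equiv (hom_set C A W) (rel_elems C R r0 r1 A))"

text \<open>
  The generalised elements of the kernel equivalence relation \<open>R[f]\<close>, given by the universal
  property of the kernel pair, and those of the inverse image along \<open>k : W \<rightarrow> Y\<close> of a relation
  on \<open>Y\<close> whose generalised elements are \<open>T\<close>.
\<close>

definition kernel_elems :: "('o, 'm) cat_data \<Rightarrow> 'o \<Rightarrow> 'm \<Rightarrow> 'o \<Rightarrow> ('m \<times> 'm) set" where
  "kernel_elems C W f A =
     {(u, v). u \<in> hom_set C A W \<and> v \<in> hom_set C A W \<and> f \<cdot>\<^bsub>C\<^esub> u = f \<cdot>\<^bsub>C\<^esub> v}"

definition inverse_image_elems ::
    "('o, 'm) cat_data \<Rightarrow> 'o \<Rightarrow> 'm \<Rightarrow> ('o \<Rightarrow> ('m \<times> 'm) set) \<Rightarrow> 'o \<Rightarrow> ('m \<times> 'm) set" where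
  "inverse_image_elems C W k T A =
     {(u, v). u \<in> hom_set C A W \<and> v \<in> hom_set C A W \<and> (k \<cdot>\<^bsub>C\<^esub> u, k \<cdot>\<^bsub>C\<^esub> v) \<in> T A}"

section \<open>Congruence hyperextensible categories\<close>

definition punctual_span ::
    "('o, 'm) cat_data \<Rightarrow> 'o \<Rightarrow> 'o \<Rightarrow> 'o \<Rightarrow> 'm \<Rightarrow> 'm \<Rightarrow> 'm \<Rightarrow> 'm \<Rightarrow> bool" where
  "punctual_span C W X Z f s g t \<longleftrightarrow>
     f \<in> hom_set C W X \<and> s \<in> hom_set C X W \<and> g \<in> hom_set C W Z \<and> t \<in> hom_set C Z W \<and>
     f \<cdot>\<^bsub>C\<^esub> s = Ident C X \<and> g \<cdot>\<^bsub>C\<^esub> t = Ident C Z \<and>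
     zero_arrow C Z X (f \<cdot>\<^bsub>C\<^esub> t) \<and> zero_arrow C X Z (g \<cdot>\<^bsub>C\<^esub> s)"

definition congruence_hyperextensible :: "('o, 'm) cat_data \<Rightarrow> bool" where
  "congruence_hyperextensible C \<longleftrightarrow>
     category C \<and> pointed_category C \<and> finitely_complete C \<and>
     (\<forall>W X Z f s g t R r0 r1. let T = rel_elems C R r0 r1 in
        punctual_span C W X Z f s g t \<longrightarrow>
        equivalence_relation_on C W R r0 r1 \<longrightarrow>
        (\<forall>A\<in>Obj C. kernel_elems C W f A \<inter> kernel_elems C W g A \<subseteq> T A) \<longrightarrow>
        (\<forall>A\<in>Obj C. kernel_elems C W f A \<inter>
            inverse_image_elems C W g (inverse_image_elems C Z t T) A \<subseteq> T A))"

section \<open>Varieties of universal algebras\<close>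

text \<open>
  The operation symbols are the elements of the type \<open>'f\<close>, with arities \<open>ar :: 'f \<Rightarrow> nat\<close>. The
  type \<open>'a\<close> plays the role of the universe of sets: all carriers are subsets of it. Only for infinite \<open>'a\<close> is this universe closed under
  finite products, up to bijection.
\<close>

datatype ('f, vars: 'v) trm = Var 'v | App 'f "('f, 'v) trm list"

record ('f, 'a) algebra =
  carrier :: "'a set"
  oper :: "'f \<Rightarrow> 'a list \<Rightarrow> 'a"

primrec wf_trm :: "('f \<Rightarrow> nat) \<Rightarrow> ('f, 'v) trm \<Rightarrow> bool" where
  "wf_trm ar (Var x) = True"
| "wf_trm ar (App f ts) = (length ts = ar f \<and> list_all (wf_trm ar) ts)"

primrec eval_trm :: "('f, 'a) algebra \<Rightarrow> ('v \<Rightarrow> 'a) \<Rightarrow> ('f, 'v) trm \<Rightarrow> 'a" where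
  "eval_trm A \<nu> (Var x) = \<nu> x"
| "eval_trm A \<nu> (App f ts) = oper A f (map (eval_trm A \<nu>) ts)"

definition is_algebra :: "('f \<Rightarrow> nat) \<Rightarrow> ('f, 'a) algebra \<Rightarrow> bool" where
  "is_algebra ar A \<longleftrightarrow>
     (\<forall>f xs. length xs = ar f \<and> set xs \<subseteq> carrier A \<longrightarrow> oper A f xs \<in> carrier A)"

definition satisfies :: "('f, 'a) algebra \<Rightarrow> ('f, nat) trm \<times> ('f, nat) trm \<Rightarrow> bool" where
  "satisfies A e \<longleftrightarrow>
     (\<forall>\<nu>. range \<nu> \<subseteq> carrier A \<longrightarrow> eval_trm A \<nu> (fst e) = eval_trm A \<nu> (snd e))"

definition variety :: "('f \<Rightarrow> nat) \<Rightarrow> ('f, 'a) algebra set \<Rightarrow> bool" where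
  "variety ar V \<longleftrightarrow>
     (\<exists>E. (\<forall>e\<in>E. wf_trm ar (fst e) \<and> wf_trm ar (snd e)) \<and>
          V = {A. is_algebra ar A \<and> (\<forall>e\<in>E. satisfies A e)})"

text \<open>An \<open>n\<close>-ary term has its variables among \<open>0, \<dots>, n - 1\<close> and induces an \<open>n\<close>-ary operation
  on every algebra.\<close>

definition nary_term :: "('f \<Rightarrow> nat) \<Rightarrow> nat \<Rightarrow> ('f, nat) trm \<Rightarrow> bool" where
  "nary_term ar n t \<longleftrightarrow> wf_trm ar t \<and> vars t \<subseteq> {..<n}"

definition term_op :: "('f, 'a) algebra \<Rightarrow> ('f, nat) trm \<Rightarrow> 'a list \<Rightarrow> 'a" where
  "term_op A t xs = eval_trm A (\<lambda>i. xs ! i) t"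

text \<open>
  Constants of a variety are its nullary terms, two of them being identified if they agree in
  all algebras of the variety. Counting only nullary operation symbols would not make the
  singleton of the constant a subalgebra.
\<close>

definition pointed_variety ::
    "('f \<Rightarrow> nat) \<Rightarrow> ('f, 'a) algebra set \<Rightarrow> ('f, nat) trm \<Rightarrow> bool" where
  "pointed_variety ar V z \<longleftrightarrow> variety ar V \<and> nary_term ar 0 z \<and>
     (\<forall>c. nary_term ar 0 c \<longrightarrow> (\<forall>A\<in>V. term_op A c [] = term_op A z []))"

definition alg_hom :: "('f \<Rightarrow> nat) \<Rightarrow> ('f, 'a) algebra \<Rightarrow> ('f, 'a) algebra \<Rightarrow> ('a \<Rightarrow> 'a) set" where
  "alg_hom ar A B = {h \<in> carrier A \<rightarrow>\<^sub>E carrier B.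
     \<forall>f xs. length xs = ar f \<and> set xs \<subseteq> carrier A \<longrightarrow> h (oper A f xs) = oper B f (map h xs)}"

text \<open>The arrow \<open>h : A \<rightarrow> B\<close> is the triple \<open>(A, h, B)\<close>.\<close>

definition variety_category :: "('f \<Rightarrow> nat) \<Rightarrow> ('f, 'a) algebra set \<Rightarrow>
    (('f, 'a) algebra, ('f, 'a) algebra \<times> ('a \<Rightarrow> 'a) \<times> ('f, 'a) algebra) cat_data" where
  "variety_category ar V =
     \<lparr>Obj = V,
      Arr = {(A, h, B). A \<in> V \<and> B \<in> V \<and> h \<in> alg_hom ar A B},
      Dom = (\<lambda>(A, h, B). A),
      Cod = (\<lambda>(A, h, B). B),
      Ident = (\<lambda>A. (A, (\<lambda>x\<in>carrier A. x), A)),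
      Comp = (\<lambda>(B', k, D) (A, h, B). (A, compose (carrier A) k h, D))\<rparr>"

end

theory Submission
  imports Defs
begin

text \<open>
  Since \<open>a \<circ> 0 = 0 \<circ> a\<close>, the elements \<open>tg(x) \<circ> sf(x)\<close> and \<open>x \<circ> 0\<close> have the same images
  under \<open>f\<close> and under \<open>g\<close>, so they are \<open>T\<close>-related. If \<open>f(x) = f(x')\<close> and \<open>tg(x) T tg(x')\<close>, then
  \<open>x \<circ> 0 T tg(x) \<circ> sf(x) T tg(x') \<circ> sf(x') T x' \<circ> 0\<close>, and applying \<open>\<upsilon>\<close> gives \<open>x T x'\<close>.
  Free algebras may be too large for the universe \<open>'a\<close>, so the passage between generalised
  elements and elements uses algebras of pairs: an infinite \<open>'a\<close> accommodates all subalgebras of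
  finite products, which also yields the finite limits.
\<close>

section \<open>Terms and homomorphisms\<close>

lemma eval_trm_closed:
  assumes "is_algebra ar A" "wf_trm ar t" "\<And>x. x \<in> vars t \<Longrightarrow> \<nu> x \<in> carrier A"
  shows "eval_trm A \<nu> t \<in> carrier A"
  using assms(2,3)
proof (induction t)
  case (App f ts)
  then have "set (map (eval_trm A \<nu>) ts) \<subseteq> carrier A"
    by (fastforce simp: list_all_iff)
  with App.prems assms(1) show ?case
    by (simp add: is_algebra_def)
qed simp

lemma eval_trm_cong:
  assumes "\<And>x. x \<in> vars t \<Longrightarrow> \<nu> x = \<mu> x"
  shows "eval_trm A \<nu> t = eval_trm A \<mu> t"
  using assms
proof (induction t)
  case (App f ts)
  then have "map (eval_trm A \<nu>) ts = map (eval_trm A \<mu>) ts"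
    by auto
  then show ?case by (metis eval_trm.simps(2))
qed simp

lemma alg_hom_closed: "h \<in> alg_hom ar A B \<Longrightarrow> x \<in> carrier A \<Longrightarrow> h x \<in> carrier B"
  by (auto simp: alg_hom_def)

lemma alg_hom_oper:
  "h \<in> alg_hom ar A B \<Longrightarrow> length xs = ar f \<Longrightarrow> set xs \<subseteq> carrier A \<Longrightarrow>
    h (oper A f xs) = oper B f (map h xs)"
  by (auto simp: alg_hom_def)

lemma alg_hom_ext:
  assumes "h \<in> alg_hom ar A B" "k \<in> alg_hom ar A B'" "\<And>x. x \<in> carrier A \<Longrightarrow> h x = k x"
  shows "h = k"
  using assms by (intro extensionalityI[of h "carrier A"]) (auto simp: alg_hom_def PiE_iff)

lemma alg_hom_eval_trm:
  assumes "is_algebra ar A" "h \<in> alg_hom ar A B" "wf_trm ar t"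
    "\<And>x. x \<in> vars t \<Longrightarrow> \<nu> x \<in> carrier A"
  shows "h (eval_trm A \<nu> t) = eval_trm B (\<lambda>x. h (\<nu> x)) t"
  using assms(3,4)
proof (induction t)
  case (App f ts)
  have "set (map (eval_trm A \<nu>) ts) \<subseteq> carrier A"
    using App.prems eval_trm_closed[OF assms(1)] by (fastforce simp: list_all_iff)
  moreover have "map h (map (eval_trm A \<nu>) ts) = map (eval_trm B (\<lambda>x. h (\<nu> x))) ts"
    using App by (auto simp: list_all_iff)
  ultimately show ?case
    using App.prems alg_hom_oper[OF assms(2), of "map (eval_trm A \<nu>) ts" f]
    by (simp del: map_map map_eq_conv)
qed simp

lemma term_op_closed:
  assumes "is_algebra ar A" "nary_term ar n t" "length xs = n" "set xs \<subseteq> carrier A"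
  shows "term_op A t xs \<in> carrier A"
  unfolding term_op_def using assms
  by (intro eval_trm_closed[of ar]) (auto simp: nary_term_def subset_iff)

lemma alg_hom_term_op:
  assumes "is_algebra ar A" "h \<in> alg_hom ar A B" "nary_term ar n t"
    "length xs = n" "set xs \<subseteq> carrier A"
  shows "h (term_op A t xs) = term_op B t (map h xs)"
proof -
  have "h (term_op A t xs) = eval_trm B (\<lambda>x. h (xs ! x)) t"
    unfolding term_op_def using assms
    by (intro alg_hom_eval_trm[of ar]) (auto simp: nary_term_def subset_iff)
  \<comment> \<open>The valuations \<open>h (xs ! x)\<close> and \<open>map h xs ! x\<close> are
    only known to agree for \<open>x < n\<close>, since list lookup beyond the length is
    unspecified. The bound on the variables of \<open>t\<close> therefore has to enter here.\<close>
  also have "\<dots> = term_op B t (map h xs)"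
    unfolding term_op_def using assms(3,4) by (intro eval_trm_cong) (auto simp: nary_term_def)
  finally show ?thesis .
qed

lemma alg_hom_id: "is_algebra ar A \<Longrightarrow> (\<lambda>x\<in>carrier A. x) \<in> alg_hom ar A A"
  by (auto simp: alg_hom_def is_algebra_def map_idI subset_iff)

lemma alg_hom_compose:
  assumes "is_algebra ar A" "h \<in> alg_hom ar A B" "k \<in> alg_hom ar B D"
  shows "compose (carrier A) k h \<in> alg_hom ar A D"
proof -
  have "compose (carrier A) k h (oper A f xs) = oper D f (map (compose (carrier A) k h) xs)"
    if xs: "length xs = ar f" "set xs \<subseteq> carrier A" for f xs
  proof -
    have "oper A f xs \<in> carrier A"
      using assms(1) xs by (auto simp: is_algebra_def)
    moreover have "set (map h xs) \<subseteq> carrier B"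
      using xs alg_hom_closed[OF assms(2)] by auto
    moreover have "map (compose (carrier A) k h) xs = map k (map h xs)"
      using xs by (auto simp: compose_eq)
    ultimately show ?thesis
      using xs alg_hom_oper[OF assms(2)] alg_hom_oper[OF assms(3), of "map h xs" f]
      by (simp add: compose_eq del: map_map map_eq_conv)
  qed
  moreover have "compose (carrier A) k h \<in> carrier A \<rightarrow>\<^sub>E carrier D"
    using alg_hom_closed[OF assms(2)] alg_hom_closed[OF assms(3)] by (auto simp: compose_def)
  ultimately show ?thesis
    by (auto simp: alg_hom_def)
qed

text \<open>Any pointwise choice of preimages is automatically a homomorphism: the two sides of the
  homomorphism equation have equal images under every \<open>p i\<close>, because \<open>p i\<close>
  and \<open>u i\<close> preserve operations, and the \<open>p i\<close> jointly separate points of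
  \<open>L\<close>. This provides both the mediating arrows of limits and the factorisations through
  jointly monic pairs.\<close>

lemma alg_hom_lift:
  assumes L: "is_algebra ar L" and A: "is_algebra ar A"
    and p: "\<And>i. i \<in> I \<Longrightarrow> p i \<in> alg_hom ar L (D i)"
    and inj: "\<And>x y. x \<in> carrier L \<Longrightarrow> y \<in> carrier L \<Longrightarrow> \<forall>i\<in>I. p i x = p i y \<Longrightarrow> x = y"
    and u: "\<And>i. i \<in> I \<Longrightarrow> u i \<in> alg_hom ar A (D i)"
    and ex: "\<And>a. a \<in> carrier A \<Longrightarrow> \<exists>x\<in>carrier L. \<forall>i\<in>I. p i x = u i a"
  shows "\<exists>h\<in>alg_hom ar A L. \<forall>i\<in>I. compose (carrier A) (p i) h = u i"
proof -
  obtain h0 where h0: "\<And>a. a \<in> carrier A \<Longrightarrow> h0 a \<in> carrier L"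
    "\<And>a i. a \<in> carrier A \<Longrightarrow> i \<in> I \<Longrightarrow> p i (h0 a) = u i a"
    using ex by metis
  \<comment> \<open>Elements of \<open>alg_hom\<close> are extensional functions, so the choice
    function has to be cut down to the carrier.\<close>
  define h where "h = restrict h0 (carrier A)"
  have h: "h a \<in> carrier L" "i \<in> I \<Longrightarrow> p i (h a) = u i a" if "a \<in> carrier A" for a i
    using h0 that by (auto simp: h_def)
  have hom: "h (oper A f xs) = oper L f (map h xs)"
    if xs: "length xs = ar f" "set xs \<subseteq> carrier A" for f xs
  proof (rule inj)
    have o: "oper A f xs \<in> carrier A"
      using A xs by (auto simp: is_algebra_def)
    then show "h (oper A f xs) \<in> carrier L" by (rule h)
    have hxs: "set (map h xs) \<subseteq> carrier L" using xs h by auto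
    then show "oper L f (map h xs) \<in> carrier L"
      using L xs by (auto simp: is_algebra_def)
    show "\<forall>i\<in>I. p i (h (oper A f xs)) = p i (oper L f (map h xs))"
    proof
      fix i assume i: "i \<in> I"
      have "map (u i) xs = map (p i) (map h xs)"
        using xs h i by auto
      then show "p i (h (oper A f xs)) = p i (oper L f (map h xs))"
        using h(2)[OF o i] alg_hom_oper[OF u[OF i] xs] alg_hom_oper[OF p[OF i] _ hxs] xs
        by (simp del: map_map map_eq_conv)
    qed
  qed
  have mem: "h \<in> alg_hom ar A L"
    using h hom by (auto simp: alg_hom_def h_def h0)
  have "compose (carrier A) (p i) h = u i" if i: "i \<in> I" for i
    using alg_hom_compose[OF A mem p[OF i]] u[OF i] h(2)[OF _ i]
    by (intro alg_hom_ext) (auto simp: compose_eq)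
  with mem show ?thesis by blast
qed

section \<open>Closure properties of varieties\<close>

lemma variety_algebra: "variety ar V \<Longrightarrow> A \<in> V \<Longrightarrow> is_algebra ar A"
  by (auto simp: variety_def)

text \<open>Homomorphisms commute with evaluation of terms, so the two sides of an identity that
  holds in every \<open>D i\<close> have the same images under all \<open>p i\<close>, and hence
  coincide in \<open>L\<close>. This is closure under subalgebras of products, phrased without
  forming the product, whose carrier would not be a subset of \<open>'a\<close>. For empty
  \<open>I\<close> it puts the algebras with at most one element into \<open>V\<close>.\<close>

lemma variety_jointly_injective:
  assumes V: "variety ar V" and L: "is_algebra ar L"
    and D: "\<And>i. i \<in> I \<Longrightarrow> D i \<in> V"
    and p: "\<And>i. i \<in> I \<Longrightarrow> p i \<in> alg_hom ar L (D i)"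
    and inj: "\<And>x y. x \<in> carrier L \<Longrightarrow> y \<in> carrier L \<Longrightarrow> \<forall>i\<in>I. p i x = p i y \<Longrightarrow> x = y"
  shows "L \<in> V"
proof -
  obtain E where E: "\<forall>e\<in>E. wf_trm ar (fst e) \<and> wf_trm ar (snd e)"
    "V = {A. is_algebra ar A \<and> (\<forall>e\<in>E. satisfies A e)}"
    using V by (auto simp: variety_def)
  have "eval_trm L \<nu> (fst e) = eval_trm L \<nu> (snd e)"
    if e: "e \<in> E" and \<nu>: "range \<nu> \<subseteq> carrier L" for e \<nu>
  proof (rule inj)
    have wf: "wf_trm ar (fst e)" "wf_trm ar (snd e)" using E e by auto
    have \<nu>': "\<nu> x \<in> carrier L" for x using \<nu> by auto
    show "eval_trm L \<nu> (fst e) \<in> carrier L" "eval_trm L \<nu> (snd e) \<in> carrier L"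
      using eval_trm_closed[OF L] wf \<nu>' by auto
    show "\<forall>i\<in>I. p i (eval_trm L \<nu> (fst e)) = p i (eval_trm L \<nu> (snd e))"
    proof
      fix i assume i: "i \<in> I"
      have "range (\<lambda>x. p i (\<nu> x)) \<subseteq> carrier (D i)"
        using alg_hom_closed[OF p[OF i]] \<nu>' by auto
      moreover have "satisfies (D i) e" using D[OF i] E(2) e by auto
      ultimately have "eval_trm (D i) (\<lambda>x. p i (\<nu> x)) (fst e) =
          eval_trm (D i) (\<lambda>x. p i (\<nu> x)) (snd e)"
        by (simp add: satisfies_def)
      then show "p i (eval_trm L \<nu> (fst e)) = p i (eval_trm L \<nu> (snd e))"
        by (simp add: alg_hom_eval_trm[OF L p[OF i] wf(1) \<nu>']
            alg_hom_eval_trm[OF L p[OF i] wf(2) \<nu>'])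
    qed
  qed
  with L E(2) show ?thesis by (auto simp: satisfies_def)
qed

text \<open>Extensional functions on \<open>I\<close> play the role of \<open>I\<close>-tuples. By
  induction on \<open>I\<close>, the entry at the new index and the code of the remaining entries
  are packed into one element, using that an infinite set is equipotent to its square.\<close>

lemma ex_inj_on_extensional:
  assumes "infinite (UNIV :: 'a set)" "finite I"
  shows "\<exists>\<phi> :: ('i \<Rightarrow> 'a) \<Rightarrow> 'a. inj_on \<phi> (extensional I)"
  using assms(2)
proof induction
  case empty
  show ?case by (auto simp: inj_on_def extensional_def fun_eq_iff)
next
  case (insert i I)
  then obtain \<phi> :: "('i \<Rightarrow> 'a) \<Rightarrow> 'a" where \<phi>: "inj_on \<phi> (extensional I)" by blast
  obtain \<pi> :: "'a \<times> 'a \<Rightarrow> 'a" where \<pi>: "inj \<pi>"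
    using card_of_Times_same_infinite[OF assms(1)]
    by (auto simp flip: card_of_ordIso simp: bij_betw_def)
  have "inj_on (\<lambda>x. \<pi> (x i, \<phi> (restrict x I))) (extensional (insert i I))"
  proof (rule inj_onI)
    fix x y :: "'i \<Rightarrow> 'a"
    assume x: "x \<in> extensional (insert i I)" and y: "y \<in> extensional (insert i I)"
      and "\<pi> (x i, \<phi> (restrict x I)) = \<pi> (y i, \<phi> (restrict y I))"
    then have eq: "x i = y i" "\<phi> (restrict x I) = \<phi> (restrict y I)"
      using \<pi> by (auto dest: injD)
    then have "restrict x I = restrict y I"
      using inj_onD[OF \<phi>] by blast
    then have "x j = y j" if "j \<in> I" for j
      using that by (metis restrict_apply')
    with eq x y show "x = y"
      by (auto intro: extensionalityI)
  qed
  then show ?case by blast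
qed

text \<open>A subalgebra \<open>S\<close> of a finite product consists of tuples, which are not
  elements of \<open>'a\<close>. It is transported along an injective coding into \<open>'a\<close>.
  The conclusion hides the coding: what remains is an object \<open>L\<close> whose projections
  identify it with \<open>S\<close>.\<close>

lemma variety_subproduct:
  fixes V :: "('f, 'a) algebra set"
  assumes inf: "infinite (UNIV :: 'a set)" and V: "variety ar V" and fin: "finite I"
    and D: "\<And>i. i \<in> I \<Longrightarrow> D i \<in> V"
    and S: "S \<subseteq> (\<Pi>\<^sub>E i\<in>I. carrier (D i))"
    and closed: "\<And>f xs. length xs = ar f \<Longrightarrow> set xs \<subseteq> S \<Longrightarrow>
      (\<lambda>i\<in>I. oper (D i) f (map (\<lambda>x. x i) xs)) \<in> S"
  obtains L p where "L \<in> V" "\<And>i. i \<in> I \<Longrightarrow> p i \<in> alg_hom ar L (D i)"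
    "bij_betw (\<lambda>x. \<lambda>i\<in>I. p i x) (carrier L) S"
proof -
  obtain \<phi> :: "('b \<Rightarrow> 'a) \<Rightarrow> 'a" where "inj_on \<phi> (extensional I)"
    using ex_inj_on_extensional[OF inf fin] by blast
  moreover have "S \<subseteq> extensional I" using S by (auto simp: PiE_def)
  ultimately have \<phi>: "inj_on \<phi> S" by (rule inj_on_subset)
  define \<psi> where "\<psi> = inv_into S \<phi>"
  have \<psi>: "\<psi> (\<phi> s) = s" if "s \<in> S" for s
    using inv_into_f_f[OF \<phi> that] by (simp add: \<psi>_def)
  \<comment> \<open>An operation decodes its arguments with \<open>\<psi>\<close>, acts in each
    component, and encodes the resulting tuple with \<open>\<phi>\<close>.\<close>
  define L where "L = \<lparr>carrier = \<phi> ` S,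
    oper = (\<lambda>f xs. \<phi> (\<lambda>i\<in>I. oper (D i) f (map (\<lambda>x. x i) (map \<psi> xs))))\<rparr>"
  define p where "p i = (\<lambda>x\<in>carrier L. \<psi> x i)" for i
  have car: "carrier L = \<phi> ` S" by (simp add: L_def)
  have \<psi>S: "set (map \<psi> xs) \<subseteq> S" if "set xs \<subseteq> carrier L" for xs
    using that \<psi> by (auto simp: car)
  have op: "oper L f xs \<in> carrier L"
    "\<psi> (oper L f xs) = (\<lambda>i\<in>I. oper (D i) f (map (\<lambda>x. x i) (map \<psi> xs)))"
    if "length xs = ar f" "set xs \<subseteq> carrier L" for f xs
  proof -
    have "(\<lambda>i\<in>I. oper (D i) f (map (\<lambda>x. x i) (map \<psi> xs))) \<in> S"
      using closed[of "map \<psi> xs" f] \<psi>S[OF that(2)] that(1) by simp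
    then show "oper L f xs \<in> carrier L"
      "\<psi> (oper L f xs) = (\<lambda>i\<in>I. oper (D i) f (map (\<lambda>x. x i) (map \<psi> xs)))"
      using \<psi> by (auto simp: L_def)
  qed
  have alg: "is_algebra ar L"
    using op by (auto simp: is_algebra_def)
  have p: "p i \<in> alg_hom ar L (D i)" if i: "i \<in> I" for i
  proof -
    have "p i (oper L f xs) = oper (D i) f (map (p i) xs)"
      if xs: "length xs = ar f" "set xs \<subseteq> carrier L" for f xs
    proof -
      have "map (\<lambda>x. x i) (map \<psi> xs) = map (p i) xs"
        using xs by (auto simp: p_def)
      then show ?thesis using op[OF xs] i by (simp add: p_def del: map_map map_eq_conv)
    qed
    moreover have "p i \<in> carrier L \<rightarrow>\<^sub>E carrier (D i)"
      using S \<psi> i by (fastforce simp: p_def car)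
    ultimately show ?thesis by (auto simp: alg_hom_def)
  qed
  \<comment> \<open>Reading off all projections of a code returns the tuple, so
    \<open>\<phi>\<close> is the inverse of the tupling map.\<close>
  have tup: "(\<lambda>i\<in>I. p i (\<phi> s)) = s" if "s \<in> S" for s
    using that \<psi> S by (intro extensionalityI[of _ I]) (auto simp: p_def car PiE_def)
  have bij: "bij_betw (\<lambda>x. \<lambda>i\<in>I. p i x) (carrier L) S"
    by (rule bij_betw_byWitness[where f' = \<phi>]) (auto simp: car tup)
  have inj: "x = y" if "x \<in> carrier L" "y \<in> carrier L" "\<forall>i\<in>I. p i x = p i y" for x y
  proof -
    have "(\<lambda>i\<in>I. p i x) = (\<lambda>i\<in>I. p i y)" using that(3) by (auto intro: restrict_ext)
    then show ?thesis using inj_onD[OF bij_betw_imp_inj_on[OF bij]] that by blast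
  qed
  have "L \<in> V"
    by (rule variety_jointly_injective[OF V alg D p inj])
  then show ?thesis using p bij by (rule that)
qed

text \<open>The binary case, with \<open>bool\<close> as index set. It turns kernel pairs, pullbacks
  and other subalgebras of \<open>A \<times> B\<close> into objects of the category, on which
  statements about generalised elements can be tested.\<close>

lemma variety_pairs:
  fixes V :: "('f, 'a) algebra set"
  assumes inf: "infinite (UNIV :: 'a set)" and V: "variety ar V" and AB: "A \<in> V" "B \<in> V"
    and S: "S \<subseteq> carrier A \<times> carrier B"
    and closed: "\<And>f xs. length xs = ar f \<Longrightarrow> set xs \<subseteq> S \<Longrightarrow>
      (oper A f (map fst xs), oper B f (map snd xs)) \<in> S"
  obtains P p0 p1 where "P \<in> V" "p0 \<in> alg_hom ar P A" "p1 \<in> alg_hom ar P B"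
    "(\<lambda>x. (p0 x, p1 x)) ` carrier P = S"
proof -
  define D where "D b = (if b then A else B)" for b
  define S' where "S' = {x. (x True, x False) \<in> S}"
  have S': "S' \<subseteq> (\<Pi>\<^sub>E i\<in>UNIV. carrier (D i))"
    using S by (auto simp: S'_def D_def)
  have closed': "(\<lambda>i\<in>UNIV. oper (D i) f (map (\<lambda>x. x i) xs)) \<in> S'"
    if "length xs = ar f" "set xs \<subseteq> S'" for f xs
    using closed[of "map (\<lambda>x. (x True, x False)) xs" f] that
    by (auto simp: S'_def D_def comp_def)
  have D: "D i \<in> V" for i using AB by (simp add: D_def)
  obtain P p where P: "P \<in> V" "\<And>i. p i \<in> alg_hom ar P (D i)"
    and bij: "bij_betw (\<lambda>x. \<lambda>i\<in>UNIV. p i x) (carrier P) S'"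
    using variety_subproduct[OF inf V finite_UNIV D S' closed'] by (metis UNIV_I)
  have "(\<lambda>y. (y True, y False)) ` S' = S"
  proof
    show "S \<subseteq> (\<lambda>y. (y True, y False)) ` S'"
    proof
      fix s assume "s \<in> S"
      then show "s \<in> (\<lambda>y. (y True, y False)) ` S'"
        by (intro image_eqI[where x = "\<lambda>b. if b then fst s else snd s"]) (auto simp: S'_def)
    qed
  qed (auto simp: S'_def)
  then have "(\<lambda>x. (p True x, p False x)) ` carrier P = S"
    unfolding bij_betw_imp_surj_on[OF bij, symmetric] by (simp add: image_image)
  with P(1) P(2)[of True] P(2)[of False] show ?thesis
    by (auto simp: D_def intro: that)
qed

section \<open>The category of a variety\<close>

lemma Obj_variety_category [simp]: "Obj (variety_category ar V) = V"
  by (simp add: variety_category_def)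

lemma Comp_variety_category [simp]:
  "(B', k, D) \<cdot>\<^bsub>variety_category ar V\<^esub> (A, h, B) = (A, compose (carrier A) k h, D)"
  by (simp add: variety_category_def)

lemma Ident_variety_category [simp]:
  "Ident (variety_category ar V) A = (A, (\<lambda>x\<in>carrier A. x), A)"
  by (simp add: variety_category_def)

lemma hom_set_variety_category:
  "F \<in> hom_set (variety_category ar V) A B \<longleftrightarrow>
    (\<exists>h\<in>alg_hom ar A B. F = (A, h, B) \<and> A \<in> V \<and> B \<in> V)"
  by (auto simp: hom_set_def variety_category_def)

lemma hom_set_variety_category_triple [simp]:
  "(A', h, B') \<in> hom_set (variety_category ar V) A B \<longleftrightarrow>
    A' = A \<and> B' = B \<and> A \<in> V \<and> B \<in> V \<and> h \<in> alg_hom ar A B"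
  by (auto simp: hom_set_variety_category)

lemma category_variety_category:
  assumes V: "variety ar V"
  shows "category (variety_category ar V)"
proof
  let ?C = "variety_category ar V"
  fix A B D F f g h
  note alg = variety_algebra[OF V]
  show "f \<in> Arr ?C \<Longrightarrow> Dom ?C f \<in> Obj ?C" "f \<in> Arr ?C \<Longrightarrow> Cod ?C f \<in> Obj ?C"
    by (auto simp: variety_category_def)
  show "A \<in> Obj ?C \<Longrightarrow> Ident ?C A \<in> hom_set ?C A A"
    by (simp add: alg_hom_id alg)
  assume f: "f \<in> hom_set ?C A B"
  then obtain f' where f': "f = (A, f', B)" "f' \<in> alg_hom ar A B" "A \<in> V" "B \<in> V"
    by (auto simp: hom_set_variety_category)
  show "Ident ?C B \<cdot>\<^bsub>?C\<^esub> f = f"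
    using f' alg_hom_compose[OF alg _ alg_hom_id[OF alg]] alg_hom_closed[OF f'(2)]
    by (auto intro!: alg_hom_ext simp: compose_eq)
  show "f \<cdot>\<^bsub>?C\<^esub> Ident ?C A = f"
    using f' alg_hom_compose[OF alg alg_hom_id[OF alg]]
    by (auto intro!: alg_hom_ext simp: compose_eq)
  assume "g \<in> hom_set ?C B D"
  then obtain g' where g': "g = (B, g', D)" "g' \<in> alg_hom ar B D" "D \<in> V"
    by (auto simp: hom_set_variety_category)
  show "g \<cdot>\<^bsub>?C\<^esub> f \<in> hom_set ?C A D"
    using f' g' alg by (auto intro: alg_hom_compose)
  assume "h \<in> hom_set ?C D F"
  then obtain h' where h': "h = (D, h', F)"
    by (auto simp: hom_set_variety_category)
  show "(h \<cdot>\<^bsub>?C\<^esub> g) \<cdot>\<^bsub>?C\<^esub> f = h \<cdot>\<^bsub>?C\<^esub> (g \<cdot>\<^bsub>?C\<^esub> f)"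
    using f' g' h' alg_hom_closed[OF f'(2)] by (auto simp: compose_def fun_eq_iff)
qed

lemma finitely_complete_variety_category:
  fixes V :: "('f, 'a) algebra set"
  assumes inf: "infinite (UNIV :: 'a set)" and V: "variety ar V"
  shows "finitely_complete (variety_category ar V)"
  unfolding finitely_complete_def
proof (intro allI impI)
  let ?C = "variety_category ar V"
  fix N D E
  assume diag: "finite_diagram ?C N D E"
  then have N: "finite N" "\<And>i. i \<in> N \<Longrightarrow> D i \<in> V"
    by (auto simp: finite_diagram_def)
  have E: "i \<in> N \<and> j \<in> N \<and> m = (D i, fst (snd m), D j) \<and> fst (snd m) \<in> alg_hom ar (D i) (D j)"
    if "(i, m, j) \<in> E" for i m j
    using diag that by (fastforce simp: finite_diagram_def hom_set_variety_category)
  \<comment> \<open>The usual limit of sets: families compatible along all edges. Arrows are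
    triples, so \<open>fst (snd m)\<close> is the underlying map of \<open>m\<close>; since it is a
    homomorphism, compatible families are closed under the operations.\<close>
  define S where "S = {x \<in> (\<Pi>\<^sub>E i\<in>N. carrier (D i)). \<forall>(i, m, j)\<in>E. fst (snd m) (x i) = x j}"
  have S: "S \<subseteq> (\<Pi>\<^sub>E i\<in>N. carrier (D i))" by (auto simp: S_def)
  have closed: "(\<lambda>i\<in>N. oper (D i) f (map (\<lambda>x. x i) xs)) \<in> S"
    if xs: "length xs = ar f" "set xs \<subseteq> S" for f xs
  proof -
    have car: "set (map (\<lambda>x. x i) xs) \<subseteq> carrier (D i)" if "i \<in> N" for i
      using xs that by (auto simp: S_def PiE_iff subset_iff)
    have "oper (D i) f (map (\<lambda>x. x i) xs) \<in> carrier (D i)" if "i \<in> N" for i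
      using variety_algebra[OF V N(2)[OF that]] car[OF that] xs(1) by (simp add: is_algebra_def)
    moreover have "fst (snd m) (oper (D i) f (map (\<lambda>x. x i) xs)) = oper (D j) f (map (\<lambda>x. x j) xs)"
      if e: "(i, m, j) \<in> E" for i m j
    proof -
      have "map (fst (snd m)) (map (\<lambda>x. x i) xs) = map (\<lambda>x. x j) xs"
        using xs e by (fastforce simp: S_def)
      then show ?thesis
        using alg_hom_oper[of "fst (snd m)" ar "D i" "D j" "map (\<lambda>x. x i) xs" f] E[OF e] car xs
        by (simp del: map_map map_eq_conv)
    qed
    ultimately show ?thesis
      using E by (fastforce simp: S_def)
  qed
  obtain L p where L: "L \<in> V" and p: "\<And>i. i \<in> N \<Longrightarrow> p i \<in> alg_hom ar L (D i)"
    and bij: "bij_betw (\<lambda>x. \<lambda>i\<in>N. p i x) (carrier L) S"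
    using variety_subproduct[OF inf V N S closed] by blast
  have inj: "x = y" if "x \<in> carrier L" "y \<in> carrier L" "\<forall>i\<in>N. p i x = p i y" for x y
  proof -
    have "(\<lambda>i\<in>N. p i x) = (\<lambda>i\<in>N. p i y)" using that(3) by (auto intro: restrict_ext)
    then show ?thesis using inj_onD[OF bij_betw_imp_inj_on[OF bij]] that by blast
  qed
  let ?p = "\<lambda>i. (L, p i, D i)"
  have "cone_over ?C N D E L ?p"
    unfolding cone_over_def
  proof (intro conjI ballI, goal_cases)
    case (3 e)
    obtain i m j where e: "e = (i, m, j)" by (cases e)
    note Ee = E[OF 3[unfolded e]]
    have "fst (snd m) (p i x) = p j x" if "x \<in> carrier L" for x
      using bij_betwE[OF bij] that 3 Ee by (fastforce simp: S_def e)
    then have "compose (carrier L) (fst (snd m)) (p i) = p j"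
      using Ee alg_hom_compose[OF variety_algebra[OF V L] p] p
      by (intro alg_hom_ext) (auto simp: compose_eq)
    moreover obtain m' where "m = (D i, m', D j)" using Ee by blast
    ultimately show ?case by (simp add: e)
  qed (use L N p in auto)
  moreover have "\<exists>!h. h \<in> hom_set ?C A L \<and> (\<forall>i\<in>N. ?p i \<cdot>\<^bsub>?C\<^esub> h = u i)"
    if cone: "cone_over ?C N D E A u" for A u
  proof -
    define u' where "u' i = fst (snd (u i))" for i
    have A: "A \<in> V" using cone by (simp add: cone_over_def)
    have u: "u i = (A, u' i, D i)" "u' i \<in> alg_hom ar A (D i)" if "i \<in> N" for i
      using cone that by (fastforce simp: cone_over_def hom_set_variety_category u'_def)+
    have u'_E: "fst (snd m) (u' i a) = u' j a" if "(i, m, j) \<in> E" "a \<in> carrier A" for i m j a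
    proof -
      have "m \<cdot>\<^bsub>?C\<^esub> u i = u j" using cone that by (auto simp: cone_over_def)
      then have "compose (carrier A) (fst (snd m)) (u' i) = u' j"
        using E[OF that(1)] u by (cases m) auto
      then show ?thesis using that by (metis compose_eq)
    qed
    have ex: "\<exists>x\<in>carrier L. \<forall>i\<in>N. p i x = u' i a" if a: "a \<in> carrier A" for a
    proof -
      have "(\<lambda>i\<in>N. u' i a) \<in> S"
        using u'_E[OF _ a] alg_hom_closed[OF u(2) a] E by (fastforce simp: S_def)
      then obtain x where eq: "(\<lambda>i\<in>N. u' i a) = (\<lambda>i\<in>N. p i x)" and x: "x \<in> carrier L"
        unfolding bij_betw_imp_surj_on[OF bij, symmetric] by (rule imageE)
      have "p i x = u' i a" if "i \<in> N" for i
        using fun_cong[OF eq, of i] that by simp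
      with x show ?thesis by blast
    qed
    obtain h where h: "h \<in> alg_hom ar A L" "\<And>i. i \<in> N \<Longrightarrow> compose (carrier A) (p i) h = u' i"
      using alg_hom_lift[OF variety_algebra[OF V L] variety_algebra[OF V A] p inj u(2) ex] by blast
    show ?thesis
    proof (rule ex1I[of _ "(A, h, L)"])
      show "(A, h, L) \<in> hom_set ?C A L \<and> (\<forall>i\<in>N. ?p i \<cdot>\<^bsub>?C\<^esub> (A, h, L) = u i)"
        using A L h u by auto
      fix k assume k: "k \<in> hom_set ?C A L \<and> (\<forall>i\<in>N. ?p i \<cdot>\<^bsub>?C\<^esub> k = u i)"
      then obtain k' where k': "k = (A, k', L)" "k' \<in> alg_hom ar A L"
        by (auto simp: hom_set_variety_category)
      have "k' a = h a" if a: "a \<in> carrier A" for a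
      proof (rule inj)
        show "\<forall>i\<in>N. p i (k' a) = p i (h a)"
        proof
          fix i assume i: "i \<in> N"
          have "compose (carrier A) (p i) k' = compose (carrier A) (p i) h"
            using k k' u[OF i] h(2)[OF i] i by auto
          then show "p i (k' a) = p i (h a)" using a by (metis compose_eq)
        qed
        show "k' a \<in> carrier L" by (rule alg_hom_closed[OF k'(2) a])
        show "h a \<in> carrier L" by (rule alg_hom_closed[OF h(1) a])
      qed
      then show "k = (A, h, L)" using k' h(1) by (auto intro: alg_hom_ext)
    qed
  qed
  ultimately show "\<exists>L p. limit_cone ?C N D E L p"
    unfolding limit_cone_def by blast
qed

section \<open>Zero objects and zero arrows\<close>

lemma pointed_varietyD:
  assumes "pointed_variety ar V z"
  shows "variety ar V" "nary_term ar 0 z"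
    "nary_term ar 0 c \<Longrightarrow> A \<in> V \<Longrightarrow> term_op A c [] = term_op A z []"
  using assms unfolding pointed_variety_def by blast+

lemma zero_closed:
  assumes "pointed_variety ar V z" "A \<in> V"
  shows "term_op A z [] \<in> carrier A"
  using term_op_closed[OF variety_algebra pointed_varietyD(2)] pointed_varietyD(1) assms by fastforce

lemma alg_hom_zero:
  assumes "pointed_variety ar V z" "A \<in> V" "h \<in> alg_hom ar A B"
  shows "h (term_op A z []) = term_op B z []"
  using alg_hom_term_op[OF variety_algebra _ pointed_varietyD(2)] pointed_varietyD(1) assms by fastforce

text \<open>Applying an operation symbol to copies of \<open>z\<close> yields another nullary term,
  and pointedness identifies all nullary terms. Thus the zero element alone forms a
  subalgebra.\<close>

lemma oper_zero:
  assumes V: "pointed_variety ar V z" and A: "A \<in> V"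
  shows "oper A f (replicate (ar f) (term_op A z [])) = term_op A z []"
proof -
  let ?c = "App f (replicate (ar f) z)"
  have "nary_term ar 0 ?c"
    using pointed_varietyD(2)[OF V] by (auto simp: nary_term_def list_all_iff)
  then have "term_op A ?c [] = term_op A z []"
    using pointed_varietyD(3)[OF V] A by blast
  then show ?thesis by (simp add: term_op_def)
qed

lemma alg_hom_const_zero:
  assumes V: "pointed_variety ar V z" and "A \<in> V" "B \<in> V"
  shows "(\<lambda>x\<in>carrier A. term_op B z []) \<in> alg_hom ar A B"
proof -
  have "is_algebra ar A" using variety_algebra[OF pointed_varietyD(1)[OF V] assms(2)] .
  moreover have "map (\<lambda>x\<in>carrier A. term_op B z []) xs = replicate (length xs) (term_op B z [])"
    if "set xs \<subseteq> carrier A" for xs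
    using that by (induction xs) auto
  ultimately show ?thesis
    using zero_closed[OF V assms(3)] oper_zero[OF V assms(3)]
    by (auto simp: alg_hom_def is_algebra_def)
qed

lemma pointed_category_variety_category:
  fixes V :: "('f, 'a) algebra set"
  assumes V: "pointed_variety ar V z"
  shows "pointed_category (variety_category ar V)"
proof -
  let ?C = "variety_category ar V"
  \<comment> \<open>The element \<open>undefined\<close> is just some element of the universe. The
    algebra lies in \<open>V\<close> because the empty family of maps already separates its single
    point.\<close>
  define N :: "('f, 'a) algebra" where "N = \<lparr>carrier = {undefined}, oper = (\<lambda>_ _. undefined)\<rparr>"
  have N: "is_algebra ar N" "carrier N = {undefined}" by (auto simp: N_def is_algebra_def)
  have NV: "N \<in> V"
    using variety_jointly_injective[OF pointed_varietyD(1)[OF V] N(1), of "{}"] N(2) by auto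
  have zN: "term_op N z [] = undefined" using zero_closed[OF V NV] N by auto
  have "zero_object ?C N"
    unfolding zero_object_def
  proof (intro conjI ballI)
    show "N \<in> Obj ?C" using NV by simp
    fix A assume "A \<in> Obj ?C"
    then have A: "A \<in> V" by simp
    have uniq_to: "h = (\<lambda>x\<in>carrier A. term_op N z [])" if "h \<in> alg_hom ar A N" for h
      using that alg_hom_const_zero[OF V A NV] alg_hom_closed[OF that]
      by (intro alg_hom_ext) (auto simp: N zN)
    show "\<exists>!f. f \<in> hom_set ?C A N"
    proof (rule ex1I)
      show "(A, (\<lambda>x\<in>carrier A. term_op N z []), N) \<in> hom_set ?C A N"
        using alg_hom_const_zero[OF V A NV] A NV by simp
      fix k assume "k \<in> hom_set ?C A N"
      then obtain h where "k = (A, h, N)" "h \<in> alg_hom ar A N"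
        by (auto simp: hom_set_variety_category)
      then show "k = (A, (\<lambda>x\<in>carrier A. term_op N z []), N)" using uniq_to[of h] by simp
    qed
    have uniq_from: "h = (\<lambda>x\<in>carrier N. term_op A z [])" if "h \<in> alg_hom ar N A" for h
      using that alg_hom_const_zero[OF V NV A] alg_hom_zero[OF V NV that]
      by (intro alg_hom_ext) (auto simp: N zN)
    show "\<exists>!f. f \<in> hom_set ?C N A"
    proof (rule ex1I)
      show "(N, (\<lambda>x\<in>carrier N. term_op A z []), A) \<in> hom_set ?C N A"
        using alg_hom_const_zero[OF V NV A] A NV by simp
      fix k assume "k \<in> hom_set ?C N A"
      then obtain h where "k = (N, h, A)" "h \<in> alg_hom ar N A"
        by (auto simp: hom_set_variety_category)
      then show "k = (N, (\<lambda>x\<in>carrier N. term_op A z []), A)" using uniq_from[of h] by simp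
    qed
  qed
  then show ?thesis by (auto simp: pointed_category_def)
qed

text \<open>The zero object in the factorisation is arbitrary, so its elements are not known. Its
  arrow to \<open>B\<close> is unique, however, and therefore equals the constant zero
  homomorphism.\<close>

lemma zero_arrow_variety_category:
  assumes V: "pointed_variety ar V z"
    and zero: "zero_arrow (variety_category ar V) A B (A, h, B)" and x: "x \<in> carrier A"
  shows "h x = term_op B z []"
proof -
  let ?C = "variety_category ar V"
  obtain N k l where N: "zero_object ?C N" and k: "(A, k, N) \<in> hom_set ?C A N"
    and l: "(N, l, B) \<in> hom_set ?C N B" and h: "h = compose (carrier A) l k"
    using zero by (auto simp: zero_arrow_def hom_set_variety_category)
  have "N \<in> V" "B \<in> V" using l by auto
  then have "(N, (\<lambda>x\<in>carrier N. term_op B z []), B) \<in> hom_set ?C N B"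
    using alg_hom_const_zero[OF V] by simp
  moreover have "\<exists>!f. f \<in> hom_set ?C N B" using N \<open>B \<in> V\<close> by (simp add: zero_object_def)
  ultimately have "l = (\<lambda>x\<in>carrier N. term_op B z [])" using l by blast
  moreover have "k x \<in> carrier N" using k x by (auto intro: alg_hom_closed)
  ultimately show ?thesis using h x by (simp add: compose_eq)
qed

section \<open>Internal equivalence relations as congruences\<close>

text \<open>The ordinary relation on elements carried by an internal relation with legs
  \<open>r0\<close> and \<open>r1\<close>, that is, the image of \<open>R\<close> in the square of
  the common codomain.\<close>

definition pair_image :: "('f, 'a) algebra \<Rightarrow> ('a \<Rightarrow> 'b) \<Rightarrow> ('a \<Rightarrow> 'b) \<Rightarrow> ('b \<times> 'b) set" where
  "pair_image R r0 r1 = (\<lambda>x. (r0 x, r1 x)) ` carrier R"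

lemma rel_elems_imp_pair_image:
  assumes "((A, u, W), (A, v, W)) \<in> rel_elems (variety_category ar V) R (R, r0, W) (R, r1, W) A"
    and "a \<in> carrier A"
  shows "(u a, v a) \<in> pair_image R r0 r1"
proof -
  obtain h where "h \<in> alg_hom ar A R" "u = compose (carrier A) r0 h" "v = compose (carrier A) r1 h"
    using assms(1) by (auto simp: rel_elems_def hom_set_variety_category)
  with assms(2) show ?thesis
    by (auto simp: pair_image_def compose_eq intro: alg_hom_closed)
qed

text \<open>The test object replacing a free algebra is the algebra \<open>P\<close> of all pairs in
  \<open>R\<close> that both legs identify. Its two projections become equal after \<open>r0\<close>
  and after \<open>r1\<close>, so joint monicity makes them equal, which says that every such pair
  is diagonal.\<close>

lemma relation_on_jointly_injective:
  fixes V :: "('f, 'a) algebra set"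
  assumes inf: "infinite (UNIV :: 'a set)" and V: "variety ar V"
    and rel: "relation_on (variety_category ar V) W R (R, r0, W) (R, r1, W)"
    and xy: "x \<in> carrier R" "y \<in> carrier R" "r0 x = r0 y" "r1 x = r1 y"
  shows "x = y"
proof -
  let ?C = "variety_category ar V"
  have R: "R \<in> V" "r0 \<in> alg_hom ar R W" "r1 \<in> alg_hom ar R W"
    using rel by (auto simp: relation_on_def)
  define S where
    "S = {(x, y). x \<in> carrier R \<and> y \<in> carrier R \<and> r0 x = r0 y \<and> r1 x = r1 y}"
  have closed: "(oper R f (map fst xs), oper R f (map snd xs)) \<in> S"
    if xs: "length xs = ar f" "set xs \<subseteq> S" for f xs
  proof -
    have car: "set (map fst xs) \<subseteq> carrier R" "set (map snd xs) \<subseteq> carrier R"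
      using xs by (auto simp: S_def)
    have "map r0 (map fst xs) = map r0 (map snd xs)" "map r1 (map fst xs) = map r1 (map snd xs)"
      using xs by (auto simp: S_def)
    then show ?thesis
      using variety_algebra[OF V R(1)] xs(1) car alg_hom_oper[OF R(2) _ car(1), of f]
        alg_hom_oper[OF R(2) _ car(2), of f] alg_hom_oper[OF R(3) _ car(1), of f]
        alg_hom_oper[OF R(3) _ car(2), of f]
      by (simp add: S_def is_algebra_def del: map_map map_eq_conv)
  qed
  have "S \<subseteq> carrier R \<times> carrier R" by (auto simp: S_def)
  then obtain P p0 p1 where P: "P \<in> V" "p0 \<in> alg_hom ar P R" "p1 \<in> alg_hom ar P R"
    and S: "(\<lambda>x. (p0 x, p1 x)) ` carrier P = S"
    using variety_pairs[OF inf V R(1) R(1) _ closed] by blast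
  have mono: "h = k" if "h \<in> hom_set ?C P R" "k \<in> hom_set ?C P R"
    "(R, r0, W) \<cdot>\<^bsub>?C\<^esub> h = (R, r0, W) \<cdot>\<^bsub>?C\<^esub> k"
    "(R, r1, W) \<cdot>\<^bsub>?C\<^esub> h = (R, r1, W) \<cdot>\<^bsub>?C\<^esub> k" for h k
    using rel P(1) that unfolding relation_on_def Obj_variety_category by blast
  have "compose (carrier P) r0 p0 = compose (carrier P) r0 p1"
    "compose (carrier P) r1 p0 = compose (carrier P) r1 p1"
    using S by (auto simp: compose_def S_def intro!: restrict_ext)
  then have "(P, p0, R) = (P, p1, R)"
    by (intro mono[of "(P, p0, R)" "(P, p1, R)"]) (simp_all add: P R)
  moreover have "(x, y) \<in> (\<lambda>x. (p0 x, p1 x)) ` carrier P" unfolding S using xy by (simp add: S_def)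
  ultimately show ?thesis by auto
qed

text \<open>This dictionary moves between generalised elements and elements. Evaluating a
  factorisation gives one direction. Conversely, joint injectivity of the legs makes pointwise
  preimages in \<open>R\<close> unique, so they assemble into a homomorphism by
  \<open>alg_hom_lift\<close>.\<close>

lemma rel_elems_iff_pair_image:
  fixes V :: "('f, 'a) algebra set"
  assumes inf: "infinite (UNIV :: 'a set)" and V: "variety ar V"
    and rel: "relation_on (variety_category ar V) W R (R, r0, W) (R, r1, W)"
    and A: "A \<in> V" and u: "u \<in> alg_hom ar A W" and v: "v \<in> alg_hom ar A W"
  shows "((A, u, W), (A, v, W)) \<in> rel_elems (variety_category ar V) R (R, r0, W) (R, r1, W) A \<longleftrightarrow>
    (\<forall>a\<in>carrier A. (u a, v a) \<in> pair_image R r0 r1)" (is "?lhs \<longleftrightarrow> ?rhs")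
proof
  assume ?rhs
  have R: "R \<in> V" "r0 \<in> alg_hom ar R W" "r1 \<in> alg_hom ar R W"
    using rel by (auto simp: relation_on_def)
  define p where "p b = (if b then r0 else r1)" for b
  define w where "w b = (if b then u else v)" for b
  have p: "p b \<in> alg_hom ar R W" and w: "w b \<in> alg_hom ar A W" for b
    using R u v by (auto simp: p_def w_def)
  have inj: "x = y" if "x \<in> carrier R" "y \<in> carrier R" "\<forall>b\<in>UNIV. p b x = p b y" for x y
  proof -
    have "p True x = p True y" "p False x = p False y" using that(3) by auto
    then show ?thesis
      using relation_on_jointly_injective[OF inf V rel that(1,2)] by (simp add: p_def)
  qed
  have "\<exists>x\<in>carrier R. \<forall>b\<in>UNIV. p b x = w b a" if "a \<in> carrier A" for a
  proof -
    have "(u a, v a) \<in> pair_image R r0 r1" using \<open>?rhs\<close> that by blast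
    then obtain x where "x \<in> carrier R" "u a = r0 x" "v a = r1 x"
      by (auto simp: pair_image_def)
    then show ?thesis by (auto simp: p_def w_def)
  qed
  then obtain h where h: "h \<in> alg_hom ar A R" "\<And>b. compose (carrier A) (p b) h = w b"
    using alg_hom_lift[OF variety_algebra[OF V R(1)] variety_algebra[OF V A],
        of UNIV p "\<lambda>_. W" w, OF p inj w]
    by blast
  have "compose (carrier A) r0 h = u" "compose (carrier A) r1 h = v"
    using h(2)[of True] h(2)[of False] by (auto simp: p_def w_def)
  then show ?lhs
    unfolding rel_elems_def using h(1) A R(1)
    by (auto intro!: exI[of _ A] exI[of _ h] exI[of _ R])
next
  assume ?lhs
  then show ?rhs by (intro ballI rel_elems_imp_pair_image)
qed

text \<open>Each property is read off at one well-chosen generalised element: reflexivity at the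
  identity of \<open>W\<close>, symmetry at the generic pair \<open>(r0, r1)\<close> over
  \<open>R\<close>, and transitivity at the pullback of \<open>r1\<close> and
  \<open>r0\<close>.\<close>

lemma equiv_pair_image:
  fixes V :: "('f, 'a) algebra set"
  assumes inf: "infinite (UNIV :: 'a set)" and V: "variety ar V"
    and eq: "equivalence_relation_on (variety_category ar V) W R (R, r0, W) (R, r1, W)"
  shows "equiv (carrier W) (pair_image R r0 r1)"
proof -
  let ?C = "variety_category ar V"
  let ?T = "rel_elems ?C R (R, r0, W) (R, r1, W)"
  have rel: "relation_on ?C W R (R, r0, W) (R, r1, W)"
    and T: "\<And>A. A \<in> V \<Longrightarrow> equiv (hom_set ?C A W) (?T A)"
    using eq by (auto simp: equivalence_relation_on_def)
  have R: "R \<in> V" "r0 \<in> alg_hom ar R W" "r1 \<in> alg_hom ar R W" and W: "W \<in> V"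
    using rel by (auto simp: relation_on_def)
  note iff = rel_elems_iff_pair_image[OF inf V rel]
  show ?thesis
  proof (rule equivI)
    show "pair_image R r0 r1 \<subseteq> carrier W \<times> carrier W"
      using R by (auto simp: pair_image_def intro: alg_hom_closed)
    have id: "(\<lambda>x\<in>carrier W. x) \<in> alg_hom ar W W"
      using alg_hom_id variety_algebra[OF V W] .
    then have "((W, (\<lambda>x\<in>carrier W. x), W), (W, (\<lambda>x\<in>carrier W. x), W)) \<in> ?T W"
      using T[OF W] W by (auto simp: equiv_def refl_on_def)
    then show "refl_on (carrier W) (pair_image R r0 r1)"
      using iff[OF W id id] by (auto simp: refl_on_def)
    have "((R, r0, W), (R, r1, W)) \<in> ?T R"
      unfolding iff[OF R] by (auto simp: pair_image_def)
    then have "((R, r1, W), (R, r0, W)) \<in> ?T R"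
      using T[OF R(1)] by (auto simp: equiv_def dest: symD)
    then have "\<forall>x\<in>carrier R. (r1 x, r0 x) \<in> pair_image R r0 r1"
      using iff[OF R(1,3,2)] by simp
    then show "sym (pair_image R r0 r1)"
      by (auto simp: sym_def) (auto simp: pair_image_def)
    show "trans (pair_image R r0 r1)"
    proof (rule transI)
      \<comment> \<open>The composable pairs, on which the second leg of the first entry meets the
        first leg of the second entry. The object \<open>P\<close> obtained from them is the
        pullback.\<close>
      define S where "S = {(x, y). x \<in> carrier R \<and> y \<in> carrier R \<and> r1 x = r0 y}"
      have closed: "(oper R f (map fst xs), oper R f (map snd xs)) \<in> S"
        if xs: "length xs = ar f" "set xs \<subseteq> S" for f xs
      proof -
        have car: "set (map fst xs) \<subseteq> carrier R" "set (map snd xs) \<subseteq> carrier R"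
          using xs by (auto simp: S_def)
        have "map r1 (map fst xs) = map r0 (map snd xs)"
          using xs by (auto simp: S_def)
        then show ?thesis
          using variety_algebra[OF V R(1)] xs(1) car alg_hom_oper[OF R(3) _ car(1), of f]
            alg_hom_oper[OF R(2) _ car(2), of f]
          by (simp add: S_def is_algebra_def del: map_map map_eq_conv)
      qed
      have "S \<subseteq> carrier R \<times> carrier R" by (auto simp: S_def)
      then obtain P p0 p1 where P: "P \<in> V" "p0 \<in> alg_hom ar P R" "p1 \<in> alg_hom ar P R"
        and S: "(\<lambda>x. (p0 x, p1 x)) ` carrier P = S"
        using variety_pairs[OF inf V R(1) R(1) _ closed] by blast
      note P' = variety_algebra[OF V P(1)]
      have homs: "compose (carrier P) r0 p0 \<in> alg_hom ar P W"
        "compose (carrier P) r1 p0 \<in> alg_hom ar P W"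
        "compose (carrier P) r1 p1 \<in> alg_hom ar P W"
        using P R P' by (auto intro: alg_hom_compose)
      \<comment> \<open>The middle terms coincide over \<open>P\<close>, so transitivity of the
        generalised relation at \<open>P\<close> can be applied to the two pairs below.\<close>
      have mid: "compose (carrier P) r1 p0 = compose (carrier P) r0 p1"
        using S by (auto simp: compose_def S_def intro!: restrict_ext)
      have "((P, compose (carrier P) r0 p0, W), (P, compose (carrier P) r1 p0, W)) \<in> ?T P"
        unfolding iff[OF P(1) homs(1,2)] using alg_hom_closed[OF P(2)]
        by (auto simp: pair_image_def compose_eq)
      moreover have "((P, compose (carrier P) r1 p0, W), (P, compose (carrier P) r1 p1, W)) \<in> ?T P"
        unfolding iff[OF P(1) homs(2,3)] using alg_hom_closed[OF P(3)]
        by (auto simp: pair_image_def compose_eq mid)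
      ultimately have "((P, compose (carrier P) r0 p0, W), (P, compose (carrier P) r1 p1, W)) \<in> ?T P"
        using T[OF P(1)] by (auto simp: equiv_def dest: transD)
      then have comp: "(r0 (p0 a), r1 (p1 a)) \<in> pair_image R r0 r1" if "a \<in> carrier P" for a
        using iff[OF P(1) homs(1,3)] that by (auto simp: compose_eq)
      fix a b c
      assume "(a, b) \<in> pair_image R r0 r1" "(b, c) \<in> pair_image R r0 r1"
      then obtain x y where xy: "a = r0 x" "c = r1 y" "(x, y) \<in> S"
        by (auto simp: pair_image_def S_def)
      then obtain d where "d \<in> carrier P" "x = p0 d" "y = p1 d" using S by force
      with comp xy show "(a, c) \<in> pair_image R r0 r1" by simp
    qed
  qed
qed

text \<open>Related pairs are lifted to elements of \<open>R\<close>, the term is evaluated there,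
  and the legs carry the result back to \<open>W\<close>. Arbitrary terms are covered because the
  two operations of the theorem are terms rather than operation symbols.\<close>

lemma pair_image_term_op:
  assumes R: "is_algebra ar R" "r0 \<in> alg_hom ar R W" "r1 \<in> alg_hom ar R W"
    and t: "nary_term ar n t" "length xs = n"
    and xs: "set xs \<subseteq> pair_image R r0 r1"
  shows "(term_op W t (map fst xs), term_op W t (map snd xs)) \<in> pair_image R r0 r1"
proof -
  have "\<exists>c\<in>carrier R. fst y = r0 c \<and> snd y = r1 c" if "y \<in> pair_image R r0 r1" for y
    using that by (auto simp: pair_image_def)
  then have "\<forall>y\<in>set xs. \<exists>c\<in>carrier R. fst y = r0 c \<and> snd y = r1 c"
    using xs by blast
  then obtain c where c: "\<forall>y\<in>set xs. c y \<in> carrier R \<and> fst y = r0 (c y) \<and> snd y = r1 (c y)"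
    by metis
  have "map fst xs = map r0 (map c xs)" "map snd xs = map r1 (map c xs)"
    using c by simp_all
  moreover have "set (map c xs) \<subseteq> carrier R" using c by auto
  ultimately have "term_op W t (map fst xs) = r0 (term_op R t (map c xs))"
    "term_op W t (map snd xs) = r1 (term_op R t (map c xs))"
    "term_op R t (map c xs) \<in> carrier R"
    using t(2) term_op_closed[OF R(1) t(1), of "map c xs"]
      alg_hom_term_op[OF R(1,2) t(1), of "map c xs"] alg_hom_term_op[OF R(1,3) t(1), of "map c xs"]
    by (simp_all del: map_map map_eq_conv)
  then show ?thesis by (auto simp: pair_image_def)
qed

section \<open>Congruence hyperextensibility\<close>

lemma hyperextension_elementwise:
  assumes V: "pointed_variety ar V z"
    and objs: "W \<in> V" "X \<in> V" "Z \<in> V"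
    and p: "nary_term ar 2 p" and q: "nary_term ar 1 q"
    and comm: "\<And>A a. A \<in> V \<Longrightarrow> a \<in> carrier A \<Longrightarrow>
      term_op A p [a, term_op A z []] = term_op A p [term_op A z [], a]"
    and ret: "\<And>A a. A \<in> V \<Longrightarrow> a \<in> carrier A \<Longrightarrow>
      term_op A q [term_op A p [a, term_op A z []]] = a"
    and homs: "f \<in> alg_hom ar W X" "s \<in> alg_hom ar X W" "g \<in> alg_hom ar W Z" "t \<in> alg_hom ar Z W"
    and split: "\<And>x. x \<in> carrier X \<Longrightarrow> f (s x) = x" "\<And>y. y \<in> carrier Z \<Longrightarrow> g (t y) = y"
    and punct: "\<And>y. y \<in> carrier Z \<Longrightarrow> f (t y) = term_op X z []"
      "\<And>x. x \<in> carrier X \<Longrightarrow> g (s x) = term_op Z z []"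
    and equiv: "equiv (carrier W) T"
    and cong: "\<And>n e xs. nary_term ar n e \<Longrightarrow> length xs = n \<Longrightarrow> set xs \<subseteq> T \<Longrightarrow>
      (term_op W e (map fst xs), term_op W e (map snd xs)) \<in> T"
    and ker: "\<And>x y. x \<in> carrier W \<Longrightarrow> y \<in> carrier W \<Longrightarrow> f x = f y \<Longrightarrow> g x = g y \<Longrightarrow> (x, y) \<in> T"
    and xy: "x \<in> carrier W" "y \<in> carrier W" "f x = f y" "(t (g x), t (g y)) \<in> T"
  shows "(x, y) \<in> T"
proof -
  have W: "is_algebra ar W" using variety_algebra[OF pointed_varietyD(1)[OF V] objs(1)] .
  note zero = zero_closed[OF V objs(1)]
  note closed = alg_hom_closed[OF homs(1)] alg_hom_closed[OF homs(2)]
    alg_hom_closed[OF homs(3)] alg_hom_closed[OF homs(4)]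
  have hom_p: "h (term_op W p [a, b]) = term_op B p [h a, h b]" "term_op W p [a, b] \<in> carrier W"
    if "h \<in> alg_hom ar W B" "a \<in> carrier W" "b \<in> carrier W" for h B a b
    using alg_hom_term_op[OF W that(1) p, of "[a, b]"] term_op_closed[OF W p, of "[a, b]"] that
    by auto
  have key: "(term_op W p [t (g w), s (f w)], term_op W p [w, term_op W z []]) \<in> T"
    if w: "w \<in> carrier W" for w
  proof (rule ker)
    show "term_op W p [t (g w), s (f w)] \<in> carrier W" "term_op W p [w, term_op W z []] \<in> carrier W"
      using hom_p(2)[OF homs(1)] w zero closed by auto
    \<comment> \<open>Since \<open>f\<close> annihilates the image of \<open>t\<close> and
      \<open>s\<close> is a section of \<open>f\<close>, the two sides are \<open>p\<close> applied
      to \<open>0, f w\<close> and to \<open>f w, 0\<close>. The commutation law is needed exactly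
      here, in \<open>X\<close>.\<close>
    show "f (term_op W p [t (g w), s (f w)]) = f (term_op W p [w, term_op W z []])"
      using w zero closed split punct comm[OF objs(2)] alg_hom_zero[OF V objs(1) homs(1)]
      by (simp add: hom_p(1)[OF homs(1)])
    \<comment> \<open>Both sides reduce to \<open>p\<close> applied to \<open>g w, 0\<close>,
      because \<open>g\<close> annihilates the image of \<open>s\<close>.\<close>
    show "g (term_op W p [t (g w), s (f w)]) = g (term_op W p [w, term_op W z []])"
      using w zero closed split punct alg_hom_zero[OF V objs(1) homs(3)]
      by (simp add: hom_p(1)[OF homs(3)])
  qed
  have refl: "refl_on (carrier W) T" and sym: "sym T" and trans: "trans T"
    using equiv by (auto simp: equiv_def)
  \<comment> \<open>The two entries are equal by \<open>f x = f y\<close>, so this is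
    reflexivity.\<close>
  have "(s (f x), s (f y)) \<in> T"
    using refl_onD[OF refl] closed xy by simp
  then have "(term_op W p [t (g x), s (f x)], term_op W p [t (g y), s (f y)]) \<in> T"
    using cong[OF p, of "[(t (g x), t (g y)), (s (f x), s (f y))]"] xy by simp
  \<comment> \<open>\<open>key\<close> at \<open>x\<close>, reversed, and \<open>key\<close> at
    \<open>y\<close> surround the previous pair; \<open>q\<close> then cancels the operation
    \<open>a \<mapsto> a \<circ> 0\<close> on both sides.\<close>
  then have "(term_op W p [x, term_op W z []], term_op W p [y, term_op W z []]) \<in> T"
    using key[OF xy(1)] key[OF xy(2)] sym trans by (meson symD transD)
  then have "(term_op W q [term_op W p [x, term_op W z []]],
      term_op W q [term_op W p [y, term_op W z []]]) \<in> T"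
    using cong[OF q, of "[(term_op W p [x, term_op W z []], term_op W p [y, term_op W z []])]"]
    by simp
  then show ?thesis using ret[OF objs(1)] xy by simp
qed

text \<open>The elements of the intersection of the two kernel congruences form an algebra
  \<open>P\<close> of pairs. Its projections are the generic generalised element of that
  intersection, so the inclusion assumed at the object \<open>P\<close> already yields the inclusion
  for elements.\<close>

lemma kernel_pairs_subset_pair_image:
  fixes V :: "('f, 'a) algebra set"
  assumes inf: "infinite (UNIV :: 'a set)" and V: "variety ar V"
    and W: "W \<in> V" and f: "f \<in> alg_hom ar W X" and g: "g \<in> alg_hom ar W Z"
    and sub: "\<And>A. A \<in> V \<Longrightarrow>
      kernel_elems (variety_category ar V) W (W, f, X) A \<inter>
        kernel_elems (variety_category ar V) W (W, g, Z) A
      \<subseteq> rel_elems (variety_category ar V) R (R, r0, W) (R, r1, W) A"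
    and xy: "x \<in> carrier W" "y \<in> carrier W" "f x = f y" "g x = g y"
  shows "(x, y) \<in> pair_image R r0 r1"
proof -
  let ?C = "variety_category ar V"
  define S where "S = {(x, y). x \<in> carrier W \<and> y \<in> carrier W \<and> f x = f y \<and> g x = g y}"
  have closed: "(oper W k (map fst xs), oper W k (map snd xs)) \<in> S"
    if xs: "length xs = ar k" "set xs \<subseteq> S" for k xs
  proof -
    have car: "set (map fst xs) \<subseteq> carrier W" "set (map snd xs) \<subseteq> carrier W"
      using xs by (auto simp: S_def)
    have "map f (map fst xs) = map f (map snd xs)" "map g (map fst xs) = map g (map snd xs)"
      using xs by (auto simp: S_def)
    then show ?thesis
      using variety_algebra[OF V W] xs(1) car alg_hom_oper[OF f _ car(1), of k]
        alg_hom_oper[OF f _ car(2), of k] alg_hom_oper[OF g _ car(1), of k]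
        alg_hom_oper[OF g _ car(2), of k]
      by (simp add: S_def is_algebra_def del: map_map map_eq_conv)
  qed
  have "S \<subseteq> carrier W \<times> carrier W" by (auto simp: S_def)
  then obtain P p0 p1 where P: "P \<in> V" "p0 \<in> alg_hom ar P W" "p1 \<in> alg_hom ar P W"
    and S: "(\<lambda>x. (p0 x, p1 x)) ` carrier P = S"
    using variety_pairs[OF inf V W W _ closed] by blast
  have "compose (carrier P) f p0 = compose (carrier P) f p1"
    "compose (carrier P) g p0 = compose (carrier P) g p1"
    using S by (auto simp: compose_def S_def intro!: restrict_ext)
  then have "((P, p0, W), (P, p1, W)) \<in> rel_elems ?C R (R, r0, W) (R, r1, W) P"
    using sub[OF P(1)] P W by (auto simp: kernel_elems_def)
  moreover have "(x, y) \<in> (\<lambda>x. (p0 x, p1 x)) ` carrier P" unfolding S using xy by (simp add: S_def)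
  ultimately show ?thesis by (auto dest: rel_elems_imp_pair_image)
qed

theorem proposition2p2:
  fixes ar :: "'f \<Rightarrow> nat"
    and V :: "('f, 'a) algebra set"
    and z p q :: "('f, nat) trm"
  assumes "infinite (UNIV :: 'a set)"
    and "pointed_variety ar V z"
    and "nary_term ar 2 p"
    and "nary_term ar 1 q"
    and "\<And>A a. A \<in> V \<Longrightarrow> a \<in> carrier A \<Longrightarrow>
           term_op A p [a, term_op A z []] = term_op A p [term_op A z [], a]"
    and "\<And>A a. A \<in> V \<Longrightarrow> a \<in> carrier A \<Longrightarrow>
           term_op A q [term_op A p [a, term_op A z []]] = a"
  shows "congruence_hyperextensible (variety_category ar V)"
proof -
  note inf = assms(1) and pV = assms(2)
  let ?C = "variety_category ar V"
  have V: "variety ar V" using pointed_varietyD(1)[OF pV] .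
  have "(u, v) \<in> rel_elems ?C R r0 r1 A"
    if span: "punctual_span ?C W X Z f s g t"
      and eq: "equivalence_relation_on ?C W R r0 r1"
      and sub: "\<forall>A\<in>Obj ?C. kernel_elems ?C W f A \<inter> kernel_elems ?C W g A \<subseteq> rel_elems ?C R r0 r1 A"
      and A: "A \<in> Obj ?C"
      and ker: "(u, v) \<in> kernel_elems ?C W f A"
      and inv: "(u, v) \<in> inverse_image_elems ?C W g
        (inverse_image_elems ?C Z t (rel_elems ?C R r0 r1)) A"
    for W X Z f s g t R r0 r1 A u v
  proof -
    obtain f' s' g' t' where arrows: "f = (W, f', X)" "s = (X, s', W)" "g = (W, g', Z)" "t = (Z, t', W)"
      and objs: "W \<in> V" "X \<in> V" "Z \<in> V"
      and homs: "f' \<in> alg_hom ar W X" "s' \<in> alg_hom ar X W" "g' \<in> alg_hom ar W Z" "t' \<in> alg_hom ar Z W"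
      using span by (auto simp: punctual_span_def hom_set_variety_category)
    obtain r0' r1' where r: "r0 = (R, r0', W)" "r1 = (R, r1', W)"
      and R: "R \<in> V" "r0' \<in> alg_hom ar R W" "r1' \<in> alg_hom ar R W"
      using eq by (auto simp: equivalence_relation_on_def relation_on_def hom_set_variety_category)
    obtain u' v' where uv: "u = (A, u', W)" "v = (A, v', W)"
      and uv_homs: "u' \<in> alg_hom ar A W" "v' \<in> alg_hom ar A W"
      and f_uv: "compose (carrier A) f' u' = compose (carrier A) f' v'"
      using ker by (auto simp: kernel_elems_def hom_set_variety_category arrows)
    let ?T = "pair_image R r0' r1'"
    have split: "compose (carrier X) f' s' = (\<lambda>x\<in>carrier X. x)"
      "compose (carrier Z) g' t' = (\<lambda>x\<in>carrier Z. x)"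
      and zero: "zero_arrow ?C Z X (Z, compose (carrier Z) f' t', X)"
      "zero_arrow ?C X Z (X, compose (carrier X) g' s', Z)"
      using span by (auto simp: punctual_span_def arrows)
    have "f' (s' x) = x" if "x \<in> carrier X" for x
      using fun_cong[OF split(1), of x] that by (simp add: compose_eq)
    moreover have "g' (t' y) = y" if "y \<in> carrier Z" for y
      using fun_cong[OF split(2), of y] that by (simp add: compose_eq)
    moreover have "f' (t' y) = term_op X z []" if "y \<in> carrier Z" for y
      using zero_arrow_variety_category[OF pV zero(1) that] that by (simp add: compose_eq)
    moreover have "g' (s' x) = term_op Z z []" if "x \<in> carrier X" for x
      using zero_arrow_variety_category[OF pV zero(2) that] that by (simp add: compose_eq)
    moreover have "equiv (carrier W) ?T"
      using equiv_pair_image[OF inf V] eq by (simp add: r)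
    moreover have "(x, y) \<in> ?T"
      if "x \<in> carrier W" "y \<in> carrier W" "f' x = f' y" "g' x = g' y" for x y
      using kernel_pairs_subset_pair_image[OF inf V objs(1) homs(1,3) _ that] sub
      by (simp add: arrows r)
    \<comment> \<open>All categorical data have now been translated into statements about elements,
      so the elementwise result applies to the congruence \<open>?T\<close>.\<close>
    ultimately have hyper: "(x, y) \<in> ?T"
      if "x \<in> carrier W" "y \<in> carrier W" "f' x = f' y" "(t' (g' x), t' (g' y)) \<in> ?T" for x y
      using hyperextension_elementwise[OF pV objs assms(3-6) homs, of ?T x y]
        pair_image_term_op[OF variety_algebra[OF V R(1)] R(2,3)] that
      by blast
    have inv': "((A, compose (carrier A) t' (compose (carrier A) g' u'), W),
        (A, compose (carrier A) t' (compose (carrier A) g' v'), W))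
        \<in> rel_elems ?C R (R, r0', W) (R, r1', W) A"
      using inv by (simp add: inverse_image_elems_def arrows uv r)
    \<comment> \<open>The generalised pair is treated one element of \<open>A\<close> at a time;
      \<open>rel_elems_iff_pair_image\<close> then reassembles the pointwise memberships into a
      factorisation through \<open>R\<close>.\<close>
    have "(u' a, v' a) \<in> ?T" if a: "a \<in> carrier A" for a
    proof (rule hyper)
      show "f' (u' a) = f' (v' a)"
        using fun_cong[OF f_uv, of a] a by (simp add: compose_eq)
      show "(t' (g' (u' a)), t' (g' (v' a))) \<in> ?T"
        using rel_elems_imp_pair_image[OF inv' a] a by (simp add: compose_eq)
    qed (use uv_homs a in \<open>auto intro: alg_hom_closed\<close>)
    moreover have "relation_on ?C W R (R, r0', W) (R, r1', W)"
      using eq by (simp add: equivalence_relation_on_def r)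
    ultimately show ?thesis
      using rel_elems_iff_pair_image[OF inf V _ _ uv_homs] A by (simp add: uv r)
  qed
  then show ?thesis
    unfolding congruence_hyperextensible_def Let_def
    using category_variety_category[OF V] pointed_category_variety_category[OF pV]
      finitely_complete_variety_category[OF inf V]
    by (intro conjI allI impI ballI subsetI) auto
qed

end
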